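(* Let $d_1,d_2\ge 2$ and $n\ge 1$. If $A$ is a $d_1$-dimensional permutation of order $n$ and $B$ is a vertex of $\Omega^{d_2}_{n}$, then the dot product $A \cdot B$ is a vertex of $\Omega^{d_1 + d_2 -2}_{n}$.
   Context: A $d$-dimensional matrix of order $n$ is an array $A=(a_\alpha)_{\alpha\in I_n^d}$ of real numbers, where $I_n^d=\{(\alpha_1,\dots,\alpha_d): \alpha_i\in\{1,\dots,n\}\}$. A line of $A$ is the set of entries obtained by fixing all indices but one and letting the remaining index run from $1$ to $n$. $A$ is polystochastic if all entries are nonnegative and the entries on every line sum to $1$. A $d$-dimensional permutation of order $n$ is a polystochastic matrix with all entries in $\{0,1\}$. $\Omega_n^d$ denotes the convex polytope of all $d$-dimensional polystochastic matrices of order $n$; a vertex of $\Omega_n^d$ is an element that cannot be written as a nontrivial convex combination of elements of $\Omega_n^d$. For a $d_1$-dimensional matrix $A$ and a $d_2$-dimensional matrix $B$, both of order $n$, the dot product $C=A\cdot B$ is the $(d_1+d_2-2)$-dimensional matrix of order $n$ with entries $c_\gamma=\sum_{i=1}^n a_{\alpha i}b_{i\beta}$, where $\gamma=\alpha\beta$ is the concatenation of $\alpha\in I_n^{d_1-1}$ and $\beta\in I_n^{d_2-1}$. *)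

theory Defs
  imports "HOL-Analysis.Analysis" "HOL-Library.Function_Algebras"
begin

text \<open>
  Pointwise scaling makes real-valued functions a real vector space (addition is that of
  \<^theory>\<open>HOL-Library.Function_Algebras\<close>), so that \<^const>\<open>extreme_point_of\<close> applies
  to sets of matrices.
\<close>

instantiation "fun" :: (type, real_vector) real_vector
begin

definition scaleR_fun :: "real \<Rightarrow> ('a \<Rightarrow> 'b) \<Rightarrow> 'a \<Rightarrow> 'b" where
  "scaleR_fun r f = (\<lambda>x. r *\<^sub>R f x)"

instance
  by standard (simp_all add: scaleR_fun_def plus_fun_def fun_eq_iff scaleR_add_right scaleR_add_left)

end

definition index_set :: "nat \<Rightarrow> nat \<Rightarrow> nat list set" where
  "index_set n d = {\<alpha>. length \<alpha> = d \<and> set \<alpha> \<subseteq> {1..n}}"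

text \<open>
  The array is indexed by \<^term>\<open>index_set n d\<close>; outside of it the function must vanish, so that
  equality of matrices is equality of functions.
\<close>

definition is_matrix :: "nat \<Rightarrow> nat \<Rightarrow> (nat list \<Rightarrow> real) \<Rightarrow> bool" where
  "is_matrix n d A \<longleftrightarrow> (\<forall>\<alpha>. \<alpha> \<notin> index_set n d \<longrightarrow> A \<alpha> = 0)"

text \<open>
  The line through \<open>\<alpha>\<close> in direction \<open>i\<close> (counted from 0) consists of the
  entries at \<open>\<alpha>[i := k]\<close> for \<open>k = 1, \<dots>, n\<close>.
\<close>

definition polystochastic :: "nat \<Rightarrow> nat \<Rightarrow> (nat list \<Rightarrow> real) \<Rightarrow> bool" where
  "polystochastic n d A \<longleftrightarrow>
     is_matrix n d A \<and>
     (\<forall>\<alpha>\<in>index_set n d. 0 \<le> A \<alpha>) \<and>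
     (\<forall>\<alpha>\<in>index_set n d. \<forall>i<d. (\<Sum>k=1..n. A (\<alpha>[i := k])) = 1)"

definition multidim_permutation :: "nat \<Rightarrow> nat \<Rightarrow> (nat list \<Rightarrow> real) \<Rightarrow> bool" where
  "multidim_permutation n d A \<longleftrightarrow>
     polystochastic n d A \<and> (\<forall>\<alpha>\<in>index_set n d. A \<alpha> \<in> {0, 1})"

definition Omega :: "nat \<Rightarrow> nat \<Rightarrow> (nat list \<Rightarrow> real) set" where
  "Omega n d = {A. polystochastic n d A}"

text \<open>
  For \<open>d\<^sub>1, d\<^sub>2 \<ge> 1\<close>, an index of the product splits as \<open>\<gamma> = \<alpha>\<beta>\<close> with
  \<open>\<alpha>\<close> of length \<open>d\<^sub>1 - 1\<close> and \<open>\<beta>\<close> of length \<open>d\<^sub>2 - 1\<close>.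
\<close>

definition dot_product ::
    "nat \<Rightarrow> nat \<Rightarrow> nat \<Rightarrow> (nat list \<Rightarrow> real) \<Rightarrow> (nat list \<Rightarrow> real) \<Rightarrow> nat list \<Rightarrow> real" where
  "dot_product n d\<^sub>1 d\<^sub>2 A B = (\<lambda>\<gamma>.
     if \<gamma> \<in> index_set n (d\<^sub>1 + d\<^sub>2 - 2)
     then \<Sum>i=1..n. A (take (d\<^sub>1 - 1) \<gamma> @ [i]) * B (i # drop (d\<^sub>1 - 1) \<gamma>)
     else 0)"

end

theory Submission
  imports Defs
begin

text \<open>
  A permutation \<open>A\<close> assigns to every \<open>\<alpha>\<close> the unique \<open>j\<close> with \<open>A (\<alpha> j) = 1\<close>, and
  \<open>(A \<cdot> B) (\<alpha>\<beta>) = B (j\<beta>)\<close>. If the first entry of \<open>\<alpha>\<close> runs over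
  \<open>1, \<dots>, n\<close>, so does \<open>j\<close>. Hence the layers of \<open>A \<cdot> B\<close> over such a line of indices are the
  layers of \<open>B\<close> in another order, and the same reordering turns any polystochastic \<open>C\<close> of dimension
  \<open>d\<^sub>1 + d\<^sub>2 - 2\<close> into one of dimension \<open>d\<^sub>2\<close>. A convex decomposition of
  \<open>A \<cdot> B\<close> therefore induces one of \<open>B\<close> over each line, and it is trivial because \<open>B\<close> is a vertex.
\<close>

section \<open>Splitting and updating index lists\<close>

lemma index_set_Cons [simp]:
  "j # \<beta> \<in> index_set n (Suc d) \<longleftrightarrow> j \<in> {1..n} \<and> \<beta> \<in> index_set n d"
  by (auto simp: index_set_def)

lemma index_set_Suc:
  assumes "\<gamma> \<in> index_set n (Suc d)"
  obtains j \<beta> where "\<gamma> = j # \<beta>" "j \<in> {1..n}" "\<beta> \<in> index_set n d"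
  using assms by (cases \<gamma>) (auto simp: index_set_def)

lemma index_set_append:
  "\<alpha> \<in> index_set n p \<Longrightarrow> \<beta> \<in> index_set n q \<Longrightarrow> \<alpha> @ \<beta> \<in> index_set n (p + q)"
  by (auto simp: index_set_def)

lemma index_set_add:
  assumes "\<gamma> \<in> index_set n (p + q)"
  obtains \<alpha> \<beta> where "\<gamma> = \<alpha> @ \<beta>" "\<alpha> \<in> index_set n p" "\<beta> \<in> index_set n q"
proof
  show "\<gamma> = take p \<gamma> @ drop p \<gamma>" by simp
qed (use assms set_take_subset[of p \<gamma>] set_drop_subset[of p \<gamma>] in \<open>auto simp: index_set_def\<close>)

lemma index_set_snoc:
  "\<alpha> \<in> index_set n p \<Longrightarrow> j \<in> {1..n} \<Longrightarrow> \<alpha> @ [j] \<in> index_set n (Suc p)"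
  by (auto simp: index_set_def)

lemma index_set_update:
  "\<alpha> \<in> index_set n d \<Longrightarrow> k \<in> {1..n} \<Longrightarrow> \<alpha>[i := k] \<in> index_set n d"
  using set_update_subset_insert[of \<alpha> i k] by (auto simp: index_set_def)

lemma length_index_set: "\<alpha> \<in> index_set n d \<Longrightarrow> length \<alpha> = d"
  by (simp add: index_set_def)

section \<open>Line sums by the position of the running index\<close>

lemma polystochastic_nonneg: "polystochastic n d A \<Longrightarrow> 0 \<le> A \<alpha>"
  by (cases "\<alpha> \<in> index_set n d") (auto simp: polystochastic_def is_matrix_def)

lemma polystochastic_outside: "polystochastic n d A \<Longrightarrow> \<alpha> \<notin> index_set n d \<Longrightarrow> A \<alpha> = 0"
  by (auto simp: polystochastic_def is_matrix_def)

lemma polystochastic_line: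
  "polystochastic n d A \<Longrightarrow> \<alpha> \<in> index_set n d \<Longrightarrow> i < d \<Longrightarrow> (\<Sum>k=1..n. A (\<alpha>[i := k])) = 1"
  by (auto simp: polystochastic_def)

lemma polystochastic_sum_hd:
  assumes "polystochastic n (Suc q) B" "\<beta> \<in> index_set n q" "n \<ge> 1"
  shows "(\<Sum>j=1..n. B (j # \<beta>)) = 1"
  \<comment> \<open>The head is overwritten by the update at 0; \<open>1\<close> is in range because
    n \<ge> 1.\<close>
  using polystochastic_line[OF assms(1), of "1 # \<beta>" 0] assms by simp

lemma polystochastic_sum_last:
  assumes "polystochastic n (Suc p) A" "\<alpha> \<in> index_set n p" "n \<ge> 1"
  shows "(\<Sum>j=1..n. A (\<alpha> @ [j])) = 1"
  using polystochastic_line[OF assms(1) index_set_snoc[OF assms(2), of 1], of p] assms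
  by (simp add: list_update_append length_index_set[OF assms(2)])

lemma polystochastic_sum_tl:
  assumes "polystochastic n (Suc q) B" "j \<in> {1..n}" "\<beta> \<in> index_set n q" "i < q"
  shows "(\<Sum>k=1..n. B (j # \<beta>[i := k])) = 1"
  using polystochastic_line[OF assms(1), of "j # \<beta>" "Suc i"] assms by simp

lemma polystochastic_sum_append_left:
  assumes "polystochastic n (p + q) C" "\<alpha> \<in> index_set n p" "\<beta> \<in> index_set n q" "i < p"
  shows "(\<Sum>k=1..n. C (\<alpha>[i := k] @ \<beta>)) = 1"
  using polystochastic_line[OF assms(1) index_set_append[OF assms(2,3)], of i] assms
  by (simp add: list_update_append length_index_set[OF assms(2)])

lemma polystochastic_sum_append_right:
  assumes "polystochastic n (p + q) C" "\<alpha> \<in> index_set n p" "\<beta> \<in> index_set n q" "i < q"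
  shows "(\<Sum>k=1..n. C (\<alpha> @ \<beta>[i := k])) = 1"
  using polystochastic_line[OF assms(1) index_set_append[OF assms(2,3)], of "p + i"] assms
  by (simp add: list_update_append length_index_set[OF assms(2)])

lemma polystochastic_sum_snoc:
  assumes "polystochastic n (Suc p) A" "\<alpha> \<in> index_set n p" "j \<in> {1..n}" "i < p"
  shows "(\<Sum>k=1..n. A (\<alpha>[i := k] @ [j])) = 1"
  using polystochastic_sum_append_left[of n p 1 A \<alpha> "[j]" i] assms by (simp add: index_set_def)

section \<open>The dot product stays polystochastic\<close>

lemma dot_product_append:
  assumes "\<alpha> \<in> index_set n p" "\<beta> \<in> index_set n q"
  shows "dot_product n (Suc p) (Suc q) A B (\<alpha> @ \<beta>) = (\<Sum>j=1..n. A (\<alpha> @ [j]) * B (j # \<beta>))"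
  using index_set_append[OF assms] by (simp add: dot_product_def length_index_set[OF assms(1)])

text \<open>After swapping the two sums, a line in one of the first \<open>p\<close> directions
  collapses \<open>A\<close> to 1 and leaves the sum of \<open>B\<close> over its head; a line in a
  later direction collapses \<open>B\<close> and leaves the sum of \<open>A\<close> over its last
  index.\<close>

lemma polystochastic_dot_product:
  assumes A: "polystochastic n (Suc p) A" and B: "polystochastic n (Suc q) B" and n: "n \<ge> 1"
  shows "polystochastic n (p + q) (dot_product n (Suc p) (Suc q) A B)"
proof -
  let ?C = "dot_product n (Suc p) (Suc q) A B"
  have "(\<Sum>k=1..n. ?C (\<gamma>[i := k])) = 1" if \<gamma>: "\<gamma> \<in> index_set n (p + q)" and i: "i < p + q" for \<gamma> i
  proof -
    obtain \<alpha> \<beta> where \<gamma>_eq: "\<gamma> = \<alpha> @ \<beta>" and \<alpha>: "\<alpha> \<in> index_set n p" and \<beta>: "\<beta> \<in> index_set n q"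
      using \<gamma> by (rule index_set_add)
    show ?thesis
    proof (cases "i < p")
      case True
      have "(\<Sum>k=1..n. ?C (\<gamma>[i := k])) = (\<Sum>k=1..n. \<Sum>j=1..n. A (\<alpha>[i := k] @ [j]) * B (j # \<beta>))"
        by (intro sum.cong refl)
          (simp add: \<gamma>_eq list_update_append length_index_set[OF \<alpha>] True
            dot_product_append[OF index_set_update[OF \<alpha>] \<beta>])
      also have "\<dots> = (\<Sum>j=1..n. (\<Sum>k=1..n. A (\<alpha>[i := k] @ [j])) * B (j # \<beta>))"
        by (subst sum.swap) (simp add: sum_distrib_right)
      also have "\<dots> = (\<Sum>j=1..n. B (j # \<beta>))"
        by (intro sum.cong refl) (simp add: polystochastic_sum_snoc[OF A \<alpha> _ True, simplified])
      finally show ?thesis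
        using polystochastic_sum_hd[OF B \<beta> n] by simp
    next
      case False
      then have i': "i - p < q" using i by simp
      have "(\<Sum>k=1..n. ?C (\<gamma>[i := k])) = (\<Sum>k=1..n. \<Sum>j=1..n. A (\<alpha> @ [j]) * B (j # \<beta>[i - p := k]))"
        by (intro sum.cong refl)
          (simp add: \<gamma>_eq list_update_append length_index_set[OF \<alpha>] False
            dot_product_append[OF \<alpha> index_set_update[OF \<beta>]])
      also have "\<dots> = (\<Sum>j=1..n. A (\<alpha> @ [j]) * (\<Sum>k=1..n. B (j # \<beta>[i - p := k])))"
        by (subst sum.swap) (simp add: sum_distrib_left)
      also have "\<dots> = (\<Sum>j=1..n. A (\<alpha> @ [j]))"
        by (intro sum.cong refl) (simp add: polystochastic_sum_tl[OF B _ \<beta> i', simplified])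
      finally show ?thesis
        using polystochastic_sum_last[OF A \<alpha> n] by simp
    qed
  qed
  moreover have "0 \<le> ?C \<gamma>" for \<gamma>
    by (auto simp: dot_product_def intro!: sum_nonneg mult_nonneg_nonneg
        polystochastic_nonneg[OF A] polystochastic_nonneg[OF B])
  moreover have "is_matrix n (p + q) ?C"
    by (simp add: is_matrix_def dot_product_def)
  ultimately show ?thesis
    by (simp add: polystochastic_def)
qed

section \<open>Pulling a matrix back along a line of indices\<close>

text \<open>
  The inverse reordering of layers: the layer of \<open>C\<close> at \<open>\<alpha>[0 := k]\<close> becomes layer \<open>j\<close>, where
  \<open>A (\<alpha>[0 := k] @ [j]) = 1\<close>.
\<close>

definition pullback ::
    "nat \<Rightarrow> nat \<Rightarrow> (nat list \<Rightarrow> real) \<Rightarrow> nat list \<Rightarrow> (nat list \<Rightarrow> real) \<Rightarrow> nat list \<Rightarrow> real" where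
  "pullback n q A \<alpha> C = (\<lambda>\<gamma>.
     if \<gamma> \<in> index_set n (Suc q)
     then \<Sum>k=1..n. A (\<alpha>[0 := k] @ [hd \<gamma>]) * C (\<alpha>[0 := k] @ tl \<gamma>)
     else 0)"

lemma pullback_Cons:
  "j \<in> {1..n} \<Longrightarrow> \<beta> \<in> index_set n q \<Longrightarrow>
    pullback n q A \<alpha> C (j # \<beta>) = (\<Sum>k=1..n. A (\<alpha>[0 := k] @ [j]) * C (\<alpha>[0 := k] @ \<beta>))"
  by (simp add: pullback_def)

text \<open>Carries a decomposition of the product over to its pullback.\<close>

lemma pullback_convex_combination:
  "pullback n q A \<alpha> ((1 - u) *\<^sub>R C + u *\<^sub>R D) =
    (1 - u) *\<^sub>R pullback n q A \<alpha> C + u *\<^sub>R pullback n q A \<alpha> D"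
  by (rule ext) (simp add: pullback_def scaleR_fun_def plus_fun_def sum_distrib_left
      distrib_left sum.distrib mult.left_commute)

text \<open>Swapping sums again: for direction 0, \<open>A\<close> sums to 1 over its last index and
  a line of \<open>C\<close> in direction 0 remains; for any other direction, a line of
  \<open>C\<close> sums to 1 and a line of \<open>A\<close> in direction 0 remains.\<close>

lemma polystochastic_pullback:
  assumes A: "polystochastic n (Suc p) A" and C: "polystochastic n (p + q) C"
    and n: "n \<ge> 1" and p: "p \<ge> 1" and \<alpha>: "\<alpha> \<in> index_set n p"
  shows "polystochastic n (Suc q) (pullback n q A \<alpha> C)"
proof -
  let ?P = "pullback n q A \<alpha> C"
  have p0: "0 < p" using p by simp
  have "(\<Sum>k=1..n. ?P (\<gamma>[i := k])) = 1"
    if \<gamma>: "\<gamma> \<in> index_set n (Suc q)" and i: "i < Suc q" for \<gamma> i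
  proof -
    obtain j \<beta> where \<gamma>_eq: "\<gamma> = j # \<beta>" and j: "j \<in> {1..n}" and \<beta>: "\<beta> \<in> index_set n q"
      using \<gamma> by (rule index_set_Suc)
    show ?thesis
    proof (cases i)
      case 0
      have "(\<Sum>m=1..n. ?P (\<gamma>[i := m])) =
          (\<Sum>m=1..n. \<Sum>k=1..n. A (\<alpha>[0 := k] @ [m]) * C (\<alpha>[0 := k] @ \<beta>))"
        using \<beta> by (intro sum.cong refl) (simp add: \<gamma>_eq 0 pullback_Cons)
      also have "\<dots> = (\<Sum>k=1..n. (\<Sum>m=1..n. A (\<alpha>[0 := k] @ [m])) * C (\<alpha>[0 := k] @ \<beta>))"
        by (subst sum.swap) (simp add: sum_distrib_right)
      also have "\<dots> = (\<Sum>k=1..n. C (\<alpha>[0 := k] @ \<beta>))"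
        by (intro sum.cong refl)
          (simp add: polystochastic_sum_last[OF A index_set_update[OF \<alpha>] n, simplified])
      finally show ?thesis
        using polystochastic_sum_append_left[OF C \<alpha> \<beta> p0] by simp
    next
      case (Suc i')
      then have i': "i' < q" using i by simp
      have "(\<Sum>m=1..n. ?P (\<gamma>[i := m])) =
          (\<Sum>m=1..n. \<Sum>k=1..n. A (\<alpha>[0 := k] @ [j]) * C (\<alpha>[0 := k] @ \<beta>[i' := m]))"
        by (intro sum.cong refl) (simp add: \<gamma>_eq Suc pullback_Cons[OF j index_set_update[OF \<beta>]])
      also have "\<dots> = (\<Sum>k=1..n. A (\<alpha>[0 := k] @ [j]) * (\<Sum>m=1..n. C (\<alpha>[0 := k] @ \<beta>[i' := m])))"
        by (subst sum.swap) (simp add: sum_distrib_left)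
      also have "\<dots> = (\<Sum>k=1..n. A (\<alpha>[0 := k] @ [j]))"
        by (intro sum.cong refl)
          (simp add: polystochastic_sum_append_right[OF C index_set_update[OF \<alpha>] \<beta> i', simplified])
      finally show ?thesis
        using polystochastic_sum_snoc[OF A \<alpha> j p0] by simp
    qed
  qed
  moreover have "0 \<le> ?P \<gamma>" for \<gamma>
    by (auto simp: pullback_def intro!: sum_nonneg mult_nonneg_nonneg
        polystochastic_nonneg[OF A] polystochastic_nonneg[OF C])
  moreover have "is_matrix n (Suc q) ?P"
    by (simp add: is_matrix_def pullback_def)
  ultimately show ?thesis
    by (simp add: polystochastic_def)
qed

section \<open>Lines of a permutation as selectors\<close>

lemma sum_mult_unit_vector:
  fixes f g :: "'a \<Rightarrow> real"
  assumes "finite S" "\<And>i. i \<in> S \<Longrightarrow> 0 \<le> f i" "sum f S = 1" "j \<in> S" "f j = 1"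
  shows "(\<Sum>i\<in>S. f i * g i) = g j"
proof -
  have "sum f (S - {j}) = 0"
    using assms sum.remove[of S j f] by simp
  then have "\<forall>i\<in>S - {j}. f i = 0"
    using assms by (subst (asm) sum_nonneg_eq_0_iff) auto
  then have "(\<Sum>i\<in>S - {j}. f i * g i) = 0"
    by simp
  then show ?thesis
    using assms sum.remove[of S j "\<lambda>i. f i * g i"] by simp
qed

lemma multidim_permutation_cases:
  assumes "multidim_permutation n d A"
  shows "A \<alpha> = 0 \<or> A \<alpha> = 1"
  using assms by (cases "\<alpha> \<in> index_set n d")
    (auto simp: multidim_permutation_def dest: polystochastic_outside)

lemma multidim_permutation_last:
  assumes A: "multidim_permutation n (Suc p) A" and \<alpha>: "\<alpha> \<in> index_set n p" and n: "n \<ge> 1"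
  obtains j where "j \<in> {1..n}" "A (\<alpha> @ [j]) = 1"
proof -
  have "(\<Sum>j=1..n. A (\<alpha> @ [j])) = 1"
    using A \<alpha> n by (intro polystochastic_sum_last) (auto simp: multidim_permutation_def)
  then obtain j where "j \<in> {1..n}" "A (\<alpha> @ [j]) \<noteq> 0"
    using sum.not_neutral_contains_not_neutral[of "\<lambda>j. A (\<alpha> @ [j])" "{1..n}"] by auto
  then show ?thesis
    using that multidim_permutation_cases[OF A, of "\<alpha> @ [j]"] by simp
qed

text \<open>The line of \<open>A\<close> over \<alpha> in the last direction is a unit vector at
  \<open>j\<close>, so one term of the product survives.\<close>

lemma dot_product_permutation:
  assumes A: "polystochastic n (Suc p) A" and \<alpha>: "\<alpha> \<in> index_set n p" and \<beta>: "\<beta> \<in> index_set n q"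
    and n: "n \<ge> 1" and j: "j \<in> {1..n}" and Aj: "A (\<alpha> @ [j]) = 1"
  shows "dot_product n (Suc p) (Suc q) A B (\<alpha> @ \<beta>) = B (j # \<beta>)"
  unfolding dot_product_append[OF \<alpha> \<beta>]
  by (rule sum_mult_unit_vector[OF _ _ polystochastic_sum_last[OF A \<alpha> n] j Aj])
    (auto simp: polystochastic_nonneg[OF A])

text \<open>The line of \<open>A\<close> in direction 0 through \<open>\<alpha> @ [j]\<close> has
  its 1 at \<open>k = \<alpha> ! 0\<close>, where the update leaves \<alpha> unchanged. Thus the
  entries of \<open>C\<close> can be recovered from its pullbacks.\<close>

lemma pullback_permutation:
  assumes A: "polystochastic n (Suc p) A" and \<alpha>: "\<alpha> \<in> index_set n p" and \<beta>: "\<beta> \<in> index_set n q"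
    and p: "p \<ge> 1" and j: "j \<in> {1..n}" and Aj: "A (\<alpha> @ [j]) = 1"
  shows "pullback n q A \<alpha> C (j # \<beta>) = C (\<alpha> @ \<beta>)"
proof -
  have len: "0 < length \<alpha>"
    using p by (simp add: length_index_set[OF \<alpha>])
  then have mem: "\<alpha> ! 0 \<in> {1..n}"
    using \<alpha> nth_mem[OF len] by (auto simp: index_set_def)
  have "(\<Sum>k=1..n. A (\<alpha>[0 := k] @ [j]) * C (\<alpha>[0 := k] @ \<beta>)) = C (\<alpha>[0 := \<alpha> ! 0] @ \<beta>)"
    by (rule sum_mult_unit_vector[OF _ _ polystochastic_sum_snoc[OF A \<alpha> j] mem])
      (use p Aj in \<open>auto simp: polystochastic_nonneg[OF A]\<close>)
  then show ?thesis
    using pullback_Cons[OF j \<beta>, of A \<alpha> C] by simp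
qed

lemma pullback_dot_product:
  assumes A: "multidim_permutation n (Suc p) A" and B: "polystochastic n (Suc q) B"
    and \<alpha>: "\<alpha> \<in> index_set n p" and n: "n \<ge> 1" and p: "p \<ge> 1"
  shows "pullback n q A \<alpha> (dot_product n (Suc p) (Suc q) A B) = B"
proof
  fix \<gamma>
  let ?C = "dot_product n (Suc p) (Suc q) A B"
  have A': "polystochastic n (Suc p) A"
    using A by (simp add: multidim_permutation_def)
  have p0: "0 < p" using p by simp
  show "pullback n q A \<alpha> ?C \<gamma> = B \<gamma>"
  proof (cases "\<gamma> \<in> index_set n (Suc q)")
    case True
    then obtain j \<beta> where \<gamma>: "\<gamma> = j # \<beta>" and j: "j \<in> {1..n}" and \<beta>: "\<beta> \<in> index_set n q"
      by (rule index_set_Suc)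
    \<comment> \<open>Where the entry of \<open>A\<close> is 0 both sides vanish; where it is 1, the
      product at \<open>\<alpha>[0 := k]\<close> shows layer \<open>j\<close> of \<open>B\<close>.
      So \<open>B (j # \<beta>)\<close> factors out of a line sum of \<open>A\<close>.\<close>
    have "A (\<alpha>[0 := k] @ [j]) * ?C (\<alpha>[0 := k] @ \<beta>) = A (\<alpha>[0 := k] @ [j]) * B (j # \<beta>)"
      if "k \<in> {1..n}" for k
      using multidim_permutation_cases[OF A, of "\<alpha>[0 := k] @ [j]"]
        dot_product_permutation[OF A' index_set_update[OF \<alpha> that] \<beta> n j]
      by auto
    then have "pullback n q A \<alpha> ?C \<gamma> = (\<Sum>k=1..n. A (\<alpha>[0 := k] @ [j])) * B (j # \<beta>)"
      by (simp only: \<gamma> pullback_Cons[OF j \<beta>] sum_distrib_right cong: sum.cong)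
    then show ?thesis
      by (simp only: polystochastic_sum_snoc[OF A' \<alpha> j p0] \<gamma> mult_1)
  next
    case False
    then show ?thesis
      by (simp add: pullback_def polystochastic_outside[OF B])
  qed
qed

section \<open>Extremality of the product\<close>

theorem theorem2:
  fixes n d\<^sub>1 d\<^sub>2 :: nat
    and A B :: "nat list \<Rightarrow> real"
  assumes "d\<^sub>1 \<ge> 2" and "d\<^sub>2 \<ge> 2" and "n \<ge> 1"
    and "multidim_permutation n d\<^sub>1 A"
    and "B extreme_point_of Omega n d\<^sub>2"
  shows "dot_product n d\<^sub>1 d\<^sub>2 A B extreme_point_of Omega n (d\<^sub>1 + d\<^sub>2 - 2)"
proof -
  obtain p q where d: "d\<^sub>1 = Suc p" "d\<^sub>2 = Suc q" and p: "p \<ge> 1"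
    using assms(1,2) by (cases d\<^sub>1; cases d\<^sub>2) auto
  let ?C = "dot_product n (Suc p) (Suc q) A B"
  have A: "multidim_permutation n (Suc p) A" and A': "polystochastic n (Suc p) A"
    using assms(4) by (auto simp: d multidim_permutation_def)
  have B: "polystochastic n (Suc q) B"
    using assms(5) by (simp add: d extreme_point_of_def Omega_def)
  have "?C \<notin> open_segment X Y"
    if X: "polystochastic n (p + q) X" and Y: "polystochastic n (p + q) Y" for X Y
  proof
    assume "?C \<in> open_segment X Y"
    then obtain u where "X \<noteq> Y" and u: "0 < u" "u < 1" and C: "?C = (1 - u) *\<^sub>R X + u *\<^sub>R Y"
      by (auto simp: in_segment)
    \<comment> \<open>One pullback sees \<open>X\<close> and \<open>Y\<close> only over a single
      line of indices, so \<alpha> has to vary over the whole index set.\<close>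
    have "X (\<alpha> @ \<beta>) = Y (\<alpha> @ \<beta>)" if \<alpha>: "\<alpha> \<in> index_set n p" and \<beta>: "\<beta> \<in> index_set n q" for \<alpha> \<beta>
    proof -
      let ?X = "pullback n q A \<alpha> X" and ?Y = "pullback n q A \<alpha> Y"
      have "B = (1 - u) *\<^sub>R ?X + u *\<^sub>R ?Y"
        using pullback_dot_product[OF A B \<alpha> \<open>n \<ge> 1\<close> p]
        by (simp only: C pullback_convex_combination)
      moreover have "?X \<in> Omega n (Suc q)" "?Y \<in> Omega n (Suc q)"
        using polystochastic_pullback[OF A' _ \<open>n \<ge> 1\<close> p \<alpha>] X Y by (auto simp: Omega_def)
      \<comment> \<open>A vertex that is a convex combination with 0 < u < 1 forces the two end
        points to coincide.\<close>
      then have "B \<notin> open_segment ?X ?Y"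
        using assms(5) by (simp add: d extreme_point_of_def)
      ultimately have "?X = ?Y"
        using u by (auto simp: in_segment)
      \<comment> \<open>Layer \<open>j\<close> of the two equal pullbacks is the layer of
        \<open>X\<close> and of \<open>Y\<close> at \<alpha>.\<close>
      moreover obtain j where "j \<in> {1..n}" "A (\<alpha> @ [j]) = 1"
        using multidim_permutation_last[OF A \<alpha> \<open>n \<ge> 1\<close>] .
      ultimately show ?thesis
        using pullback_permutation[OF A' \<alpha> \<beta> p] by metis
    qed
    \<comment> \<open>Outside the index set both matrices take the default value 0, so they agree as
      functions.\<close>
    then have "X \<gamma> = Y \<gamma>" for \<gamma>
      by (cases "\<gamma> \<in> index_set n (p + q)")
        (auto simp: polystochastic_outside[OF X] polystochastic_outside[OF Y] elim: index_set_add)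
    then show False
      using \<open>X \<noteq> Y\<close> by blast
  qed
  then show ?thesis
    using polystochastic_dot_product[OF A' B \<open>n \<ge> 1\<close>]
    by (simp add: d extreme_point_of_def Omega_def)
qed

end
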